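(* Let $\mathcal{X}$ be a Polish space, $X=(X_n)_{n\ge 1}$ an $\mathcal{X}$-valued process, and $P$ a random measure on $\mathcal{X}$. Consider the following statements: (i) $X$ is empirically weakly converging (EWC) in probability with limit measure $P$; (ii) for any strictly increasing sequence $(k_n)_{n\ge1}$ of positive integers, there exists a subsequence $(k_{m_n})_{n\ge1}$ such that $$\mathbb{P}\left[\forall f\in C_{\mathrm b}(\mathcal{X};\mathbb{R}),\ \limsup_{n}\lvert \eta_{k_{m_n}}^X f - Pf\rvert = 0\right]=1;$$ (iii) for all $f\in C_{\mathrm b}(\mathcal{X};\mathbb{R})$, $\lim_{n\to\infty}\eta_n^X f = Pf$, where the convergence is in probability. Then (i) $\iff$ (ii) $\implies$ (iii). If, additionally, $\mathcal{X}$ is compact, then the implication (iii) $\implies$ (ii) also holds and all of the statements are equivalent.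
   Context: All random variables are defined on a complete standard Borel probability space $(\Omega,\mathcal{A},\mathbb{P})$. Polish spaces carry their Borel $\sigma$-algebra. $\mathcal{P}(\mathcal{X})$ is the set of Borel probability measures on $\mathcal{X}$ with the topology of weak convergence (which is metrizable). A random measure on $\mathcal{X}$ is a measurable map $P:\Omega\to\mathcal{P}(\mathcal{X})$. $C_{\mathrm b}(\mathcal{X};\mathbb{R})$ is the set of continuous bounded real functions on $\mathcal{X}$, and $Pf:=\int_{\mathcal{X}} f\,\mathrm{d}P$. The empirical measure of a process $X$ is $\eta_n^X=\frac1n\sum_{i=1}^n\delta_{X_i}$. Definition (EWC): let $d$ be a metric on $\mathcal{P}(\mathcal{X})$ that metrizes weak convergence. An $\mathcal{X}$-valued process $X$ is EWC in probability (resp. almost surely) if there exists a random measure $P$ on $\mathcal{X}$ such that $\lim_{n\to\infty}d(\eta_n^X,P)=0$ in probability (resp. almost surely); $P$ is then called a limit measure of $X$. *)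

theory Defs
  imports "HOL-Probability.Probability"
begin

section \<open>Complete standard Borel probability spaces\<close>

definition standard_borel :: "'w measure \<Rightarrow> bool" where
  "standard_borel N \<longleftrightarrow>
     (\<exists>T. completely_metrizable_space T \<and> second_countable T \<and> topspace T = space N \<and>
          sets N = sigma_sets (space N) {U. openin T U})"

definition complete_standard_borel_prob_space :: "'w measure \<Rightarrow> bool" where
  "complete_standard_borel_prob_space M \<longleftrightarrow>
     prob_space M \<and> (\<exists>N. standard_borel N \<and> M = completion N)"

section \<open>Borel probability measures and weak convergence\<close>

definition borel_probs :: "'a::topological_space measure set" where
  "borel_probs = {\<mu>. sets \<mu> = sets borel \<and> prob_space \<mu>}"

text \<open>The coarsest topology on \<^term>\<open>borel_probs\<close> that makes all maps
  \<open>\<mu> \<mapsto> \<integral>f d\<mu>\<close> with \<open>f\<close> bounded and continuous continuous.\<close>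

definition weak_topology :: "'a::topological_space measure topology" where
  "weak_topology = topology_generated_by
     {{\<mu> \<in> borel_probs. (\<integral>x. apply_bcontfun f x \<partial>\<mu>) \<in> U} | (f :: 'a \<Rightarrow>\<^sub>C real) U. open U}"

lemma topspace_weak_topology: "topspace weak_topology = borel_probs"
proof -
  have "borel_probs \<in> {{\<mu> \<in> borel_probs. (\<integral>x. apply_bcontfun f x \<partial>\<mu>) \<in> U} |
          (f :: 'a \<Rightarrow>\<^sub>C real) U. open U}"
    by (rule CollectI, rule exI[of _ 0], rule exI[of _ UNIV]) simp
  then show ?thesis
    unfolding weak_topology_def topology_generated_by_topspace by blast
qed

definition weak_borel :: "'a::topological_space measure measure" where
  "weak_borel = sigma borel_probs {U. openin weak_topology U}"

definition random_measure :: "'w measure \<Rightarrow> ('w \<Rightarrow> 'a::topological_space measure) \<Rightarrow> bool" where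
  "random_measure M P \<longleftrightarrow> P \<in> M \<rightarrow>\<^sub>M weak_borel"

definition metrizes_weak_convergence ::
    "('a::topological_space measure \<Rightarrow> 'a measure \<Rightarrow> real) \<Rightarrow> bool" where
  "metrizes_weak_convergence d \<longleftrightarrow>
     Metric_space borel_probs d \<and> Metric_space.mtopology borel_probs d = weak_topology"

section \<open>Empirical measures\<close>

text \<open>Only \<open>X 1, X 2, \<dots>\<close> are used; the value \<open>X 0\<close> plays no role.\<close>

definition empirical_measure ::
    "(nat \<Rightarrow> 'w \<Rightarrow> 'a::topological_space) \<Rightarrow> nat \<Rightarrow> 'w \<Rightarrow> 'a measure" where
  "empirical_measure X n \<omega> =
     measure_of UNIV (sets borel)
       (\<lambda>A. ennreal (1 / real n) * (\<Sum>i=1..n. emeasure (return borel (X i \<omega>)) A))"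

lemma sets_empirical_measure [simp]: "sets (empirical_measure X n \<omega>) = sets borel"
  and space_empirical_measure [simp]: "space (empirical_measure X n \<omega>) = UNIV"
  unfolding empirical_measure_def
  by (metis sets.sets_measure_of_eq space_borel) simp

lemma emeasure_empirical_measure:
  fixes X :: "nat \<Rightarrow> 'w \<Rightarrow> 'a::topological_space"
  assumes "A \<in> sets borel"
  shows "emeasure (empirical_measure X n \<omega>) A =
    ennreal (1 / real n) * (\<Sum>i=1..n. emeasure (return borel (X i \<omega>)) A)"
proof (rule emeasure_measure_of[OF empirical_measure_def])
  let ?\<mu> = "\<lambda>A. ennreal (1 / real n) * (\<Sum>i=1..n. emeasure (return borel (X i \<omega>)) A)"
  show "countably_additive (sets (empirical_measure X n \<omega>)) ?\<mu>"
  proof (rule countably_additiveI)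
    fix F :: "nat \<Rightarrow> 'a set"
    assume F: "range F \<subseteq> sets (empirical_measure X n \<omega>)" "disjoint_family F"
    have "(\<Sum>j. ?\<mu> (F j)) = ennreal (1 / real n) *
        (\<Sum>j. \<Sum>i=1..n. emeasure (return borel (X i \<omega>)) (F j))"
      by (rule ennreal_suminf_cmult)
    also have "(\<Sum>j. \<Sum>i=1..n. emeasure (return borel (X i \<omega>)) (F j)) =
        (\<Sum>i=1..n. \<Sum>j. emeasure (return borel (X i \<omega>)) (F j))"
      by (rule suminf_sum) auto
    also have "\<dots> = (\<Sum>i=1..n. emeasure (return borel (X i \<omega>)) (\<Union> (range F)))"
      using F by (intro sum.cong refl suminf_emeasure) auto
    finally show "(\<Sum>j. ?\<mu> (F j)) = ?\<mu> (\<Union> (range F))" .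
  qed
qed (use assms in \<open>auto simp: positive_def\<close>)

lemma empirical_measure_in_borel_probs:
  assumes "n \<ge> 1"
  shows "empirical_measure X n \<omega> \<in> borel_probs"
proof -
  have "emeasure (empirical_measure X n \<omega>) UNIV = ennreal (1 / real n) * ennreal (real n)"
    using assms by (subst emeasure_empirical_measure) (auto simp: ennreal_of_nat_eq_real_of_nat)
  also have "\<dots> = 1"
    using assms by (subst ennreal_mult[symmetric]) auto
  finally show ?thesis
    by (auto simp: borel_probs_def intro!: prob_spaceI)
qed

section \<open>The three modes of convergence\<close>

text \<open>Only used where the events below are measurable: for real-valued random variables with the
  Euclidean distance, and for random measures with a metric that metrizes weak convergence (on a
  Polish space the weak topology is separable, so such a metric is jointly measurable).\<close>

definition tendsto_in_prob ::
    "'w measure \<Rightarrow> ('b \<Rightarrow> 'b \<Rightarrow> real) \<Rightarrow> (nat \<Rightarrow> 'w \<Rightarrow> 'b) \<Rightarrow> ('w \<Rightarrow> 'b) \<Rightarrow> bool" where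
  "tendsto_in_prob M d Z Z' \<longleftrightarrow>
     (\<forall>\<epsilon>>0. (\<lambda>n. \<P>(\<omega> in M. d (Z n \<omega>) (Z' \<omega>) > \<epsilon>)) \<longlonglongrightarrow> 0)"

definition EWC_in_prob_with_limit ::
    "'w measure \<Rightarrow> ('a::topological_space measure \<Rightarrow> 'a measure \<Rightarrow> real) \<Rightarrow>
     (nat \<Rightarrow> 'w \<Rightarrow> 'a) \<Rightarrow> ('w \<Rightarrow> 'a measure) \<Rightarrow> bool" where
  "EWC_in_prob_with_limit M d X P \<longleftrightarrow>
     random_measure M P \<and> tendsto_in_prob M d (empirical_measure X) P"

text \<open>The sequences \<open>k\<close> and \<open>m\<close> are indexed from \<open>0\<close>, a mere relabelling.  An event
  that is not measurable has probability \<open>0\<close> by convention, so the equation below includes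
  the measurability of the event.\<close>

definition subseq_AS_weak_convergence ::
    "'w measure \<Rightarrow> (nat \<Rightarrow> 'w \<Rightarrow> 'a::topological_space) \<Rightarrow> ('w \<Rightarrow> 'a measure) \<Rightarrow> bool" where
  "subseq_AS_weak_convergence M X P \<longleftrightarrow>
     (\<forall>k :: nat \<Rightarrow> nat. strict_mono k \<and> (\<forall>n. k n > 0) \<longrightarrow>
       (\<exists>m :: nat \<Rightarrow> nat. strict_mono m \<and>
         \<P>(\<omega> in M. \<forall>f :: 'a \<Rightarrow>\<^sub>C real.
             limsup (\<lambda>n. ereal \<bar>(\<integral>x. apply_bcontfun f x \<partial>empirical_measure X (k (m n)) \<omega>)
                              - (\<integral>x. apply_bcontfun f x \<partial>P \<omega>)\<bar>) = 0) = 1))"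

definition integrals_tendsto_in_prob ::
    "'w measure \<Rightarrow> (nat \<Rightarrow> 'w \<Rightarrow> 'a::topological_space) \<Rightarrow> ('w \<Rightarrow> 'a measure) \<Rightarrow> bool" where
  "integrals_tendsto_in_prob M X P \<longleftrightarrow>
     (\<forall>f :: 'a \<Rightarrow>\<^sub>C real.
        tendsto_in_prob M dist
          (\<lambda>n \<omega>. \<integral>x. apply_bcontfun f x \<partial>empirical_measure X n \<omega>)
          (\<lambda>\<omega>. \<integral>x. apply_bcontfun f x \<partial>P \<omega>))"

end

theory Submission
  imports Defs
begin

text \<open>Convergence in probability is equivalent to every subsequence having an almost surely
  convergent sub-subsequence, provided the relevant distances are measurable.  For \<open>d\<close> this holds
  because an empirical measure is a continuous image of the separable space of sequences.  On a
  compact space countably many test functions determine weak convergence, so convergence in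
  probability for each of them can be turned into almost sure convergence along one subsequence by a
  single Borel--Cantelli argument.\<close>

section \<open>The weak topology\<close>

text \<open>For a fixed outcome, the condition over all test functions in the second statement says
  that one real sequence of distances tends to 0, so a single null set serves all functions at once.
  The third statement gives a subsequence and a null set for each function separately, and these
  have to be merged. The event over all test functions is an uncountable intersection whose
  measurability is part of the claim; completeness of the probability space supplies it. The index 0
  is kept out throughout: \<open>empirical_measure X 0\<close> is the zero measure, which lies
  outside \<open>borel_probs\<close>, so weak convergence says nothing about \<open>d\<close>
  there.\<close>

lemma limitin_topology_generated_by:
  "limitin (topology_generated_by \<S>) f l F \<longleftrightarrow>
     l \<in> \<Union>\<S> \<and> (\<forall>U\<in>\<S>. l \<in> U \<longrightarrow> (\<forall>\<^sub>F x in F. f x \<in> U))" (is "?L \<longleftrightarrow> ?R")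
proof
  show ?R if ?L
    using that by (auto simp: limitin_def intro: topology_generated_by_Basis)
  show ?L if R: ?R
  proof -
    \<comment> \<open>Eventual membership passes from the subbasis to finite intersections because
      \<open>F\<close> is a filter, and to unions because one member already contains
      \<open>l\<close>.\<close>
    have "\<forall>\<^sub>F x in F. f x \<in> U" if "generate_topology_on \<S> U" "l \<in> U" for U
      using that
    proof (induction rule: generate_topology_on.induct)
      case (Int a b)
      then show ?case by (auto simp: eventually_conj_iff)
    next
      case (UN K)
      then obtain k where "k \<in> K" "l \<in> k" by auto
      with UN.IH[of k] show ?case by (auto elim: eventually_mono)
    qed (use R in auto)
    with R show ?L by (auto simp: limitin_def openin_topology_generated_by_iff)
  qed
qed

lemma openin_weak_topology_integral:
  fixes f :: "'a::topological_space \<Rightarrow>\<^sub>C real"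
  assumes "open U"
  shows "openin weak_topology {\<mu> \<in> borel_probs. (\<integral>x. apply_bcontfun f x \<partial>\<mu>) \<in> U}"
  unfolding weak_topology_def using assms by (intro topology_generated_by_Basis) blast

text \<open>Stated for an arbitrary filter, so that \<open>sequentially\<close> gives convergence of
  sequences of measures and \<open>atin\<close> gives continuity of maps into the weak
  topology.\<close>

lemma limitin_weak_topology:
  "limitin weak_topology \<mu> \<nu> F \<longleftrightarrow>
     \<nu> \<in> borel_probs \<and> (\<forall>\<^sub>F x in F. \<mu> x \<in> borel_probs) \<and>
     (\<forall>f :: 'a::topological_space \<Rightarrow>\<^sub>C real.
        ((\<lambda>x. \<integral>y. apply_bcontfun f y \<partial>\<mu> x) \<longlongrightarrow> (\<integral>y. apply_bcontfun f y \<partial>\<nu>)) F)"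
  (is "?L \<longleftrightarrow> ?R")
proof
  assume L: ?L
  then have \<nu>: "\<nu> \<in> borel_probs"
    using limitin_topspace by (simp flip: topspace_weak_topology)
  have ev_openin: "\<forall>\<^sub>F x in F. \<mu> x \<in> V" if "openin weak_topology V" "\<nu> \<in> V" for V
    using L that by (simp add: limitin_def)
  have ev: "\<forall>\<^sub>F x in F. \<mu> x \<in> borel_probs"
    using ev_openin[OF openin_topspace] \<nu> by (simp add: topspace_weak_topology)
  have "\<forall>\<^sub>F x in F. (\<integral>y. apply_bcontfun f y \<partial>\<mu> x) \<in> U"
    if "open U" "(\<integral>y. apply_bcontfun f y \<partial>\<nu>) \<in> U" for f :: "'a \<Rightarrow>\<^sub>C real" and U
  proof -
    have "\<forall>\<^sub>F x in F. \<mu> x \<in> {\<mu> \<in> borel_probs. (\<integral>x. apply_bcontfun f x \<partial>\<mu>) \<in> U}"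
      using that \<nu> by (intro ev_openin openin_weak_topology_integral) auto
    then show ?thesis by (auto elim: eventually_mono)
  qed
  then show ?R using \<nu> ev by (auto simp: tendsto_def)
next
  assume R: ?R
  have "\<nu> \<in> topspace weak_topology" using R by (simp add: topspace_weak_topology)
  with R show ?L
    unfolding weak_topology_def limitin_topology_generated_by
    by (auto simp: tendsto_def eventually_conj_iff)
qed

lemma continuous_map_weak_topologyI:
  fixes g :: "'b \<Rightarrow> 'a::topological_space measure"
  assumes "\<And>x. x \<in> topspace T \<Longrightarrow> g x \<in> borel_probs"
    and "\<And>f :: 'a \<Rightarrow>\<^sub>C real. continuous_map T euclidean (\<lambda>x. \<integral>y. apply_bcontfun f y \<partial>g x)"
  shows "continuous_map T weak_topology g"
  unfolding continuous_map_atin limitin_weak_topology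
proof (intro ballI conjI allI)
  fix x and f :: "'a \<Rightarrow>\<^sub>C real" assume x: "x \<in> topspace T"
  show "g x \<in> borel_probs" using assms(1) x by blast
  show "\<forall>\<^sub>F y in atin T x. g y \<in> borel_probs"
    using x assms(1) by (auto simp: eventually_atin)
  show "((\<lambda>x. \<integral>y. apply_bcontfun f y \<partial>g x) \<longlongrightarrow> (\<integral>y. apply_bcontfun f y \<partial>g x)) (atin T x)"
    using assms(2)[of f] x by (simp add: continuous_map_atin)
qed

lemma space_weak_borel:
    "space weak_borel = (borel_probs :: 'a::topological_space measure set)"
  and sets_weak_borel:
    "sets weak_borel = sigma_sets borel_probs {U. openin (weak_topology :: 'a measure topology) U}"
proof -
  have "{U. openin weak_topology U} \<subseteq> Pow (borel_probs :: 'a measure set)"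
    using openin_subset topspace_weak_topology by fastforce
  then show "space weak_borel = (borel_probs :: 'a measure set)"
    "sets weak_borel = sigma_sets borel_probs {U. openin (weak_topology :: 'a measure topology) U}"
    by (simp_all add: weak_borel_def)
qed

lemma openin_weak_topology_sets: "openin weak_topology U \<Longrightarrow> U \<in> sets weak_borel"
  by (auto simp: sets_weak_borel)

lemma measurable_integral_weak_borel:
  fixes f :: "'a::topological_space \<Rightarrow>\<^sub>C real"
  shows "(\<lambda>\<mu>. \<integral>x. apply_bcontfun f x \<partial>\<mu>) \<in> borel_measurable weak_borel"
proof (rule borel_measurableI)
  fix S :: "real set" assume "open S"
  from openin_weak_topology_sets[OF openin_weak_topology_integral[OF this, of f]]
  show "(\<lambda>\<mu>. \<integral>x. apply_bcontfun f x \<partial>\<mu>) -` S \<inter> space weak_borel \<in> sets weak_borel"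
    by (simp add: space_weak_borel vimage_def Int_def conj_commute)
qed

lemma integrable_bcontfun:
  fixes f :: "'a::topological_space \<Rightarrow>\<^sub>C real"
  assumes "\<mu> \<in> borel_probs"
  shows "integrable \<mu> (apply_bcontfun f)"
proof -
  interpret prob_space \<mu> using assms by (simp add: borel_probs_def)
  have [measurable_cong]: "sets \<mu> = sets borel" using assms by (simp add: borel_probs_def)
  have [measurable]: "apply_bcontfun f \<in> borel_measurable borel"
    by (intro borel_measurable_continuous_onI) simp
  show ?thesis
    by (rule integrable_const_bound[of _ "norm f"]) (use norm_bounded[of f] in auto)
qed

section \<open>Empirical measures as random measures\<close>

text \<open>The empirical measure is the pushforward of the uniform distribution on
  \<open>{1..n}\<close> under the map from \<open>i\<close> to \<open>X i \<omega>\<close>, so its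
  integrals are averages. For \<open>n = 0\<close> both sides are 0.\<close>

lemma integral_empirical_measure:
  fixes f :: "'a::topological_space \<Rightarrow> real"
  assumes [measurable]: "f \<in> borel_measurable borel"
  shows "(\<integral>x. f x \<partial>empirical_measure X n \<omega>) = (\<Sum>i=1..n. f (X i \<omega>)) / real n"
proof -
  let ?U = "uniform_count_measure {1..n}"
  have X: "(\<lambda>i. X i \<omega>) \<in> ?U \<rightarrow>\<^sub>M borel"
    by (simp add: measurable_def sets_uniform_count_measure space_uniform_count_measure)
  have "empirical_measure X n \<omega> = distr ?U borel (\<lambda>i. X i \<omega>)"
  proof (rule measure_eqI)
    fix A assume "A \<in> sets (empirical_measure X n \<omega>)"
    then have [measurable]: "A \<in> sets borel" by simp
    let ?S = "(\<lambda>i. X i \<omega>) -` A \<inter> {1..n}"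
    have "(\<Sum>i=1..n. emeasure (return borel (X i \<omega>)) A) = (\<Sum>i=1..n. indicator ?S i)"
      by (intro sum.cong) (auto simp: indicator_def)
    also have "\<dots> = of_nat (card ?S)"
      by (simp add: indicator_def sum.If_cases Int_commute vimage_def)
    finally have "emeasure (empirical_measure X n \<omega>) A = ennreal (1 / real n) * ennreal (real (card ?S))"
      by (simp add: emeasure_empirical_measure ennreal_of_nat_eq_real_of_nat)
    also have "\<dots> = ennreal (card ?S / n)"
      by (subst ennreal_mult[symmetric]) auto
    also have "\<dots> = emeasure (distr ?U borel (\<lambda>i. X i \<omega>)) A"
      by (subst emeasure_distr[OF X])
         (auto simp: space_uniform_count_measure emeasure_uniform_count_measure)
    finally show "emeasure (empirical_measure X n \<omega>) A = emeasure (distr ?U borel (\<lambda>i. X i \<omega>)) A" .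
  qed simp
  moreover have "(\<integral>x. f x \<partial>distr ?U borel (\<lambda>i. X i \<omega>)) = (\<integral>i. f (X i \<omega>) \<partial>?U)"
    by (rule integral_distr[OF X assms])
  ultimately show ?thesis
    by (simp add: integral_uniform_count_measure)
qed

text \<open>The two processes may live on different spaces: this permits replacing a process at an
  outcome by the coordinate process at its path, and altering the value at index 0.\<close>

lemma empirical_measure_cong:
  assumes "\<And>i. 1 \<le> i \<Longrightarrow> i \<le> n \<Longrightarrow> X i \<omega> = Y i \<omega>'"
  shows "empirical_measure X n \<omega> = empirical_measure Y n \<omega>'"
proof -
  have "(\<Sum>i=1..n. emeasure (return borel (X i \<omega>)) A) = (\<Sum>i=1..n. emeasure (return borel (Y i \<omega>')) A)"
    for A by (intro sum.cong) (auto simp: assms)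
  then show ?thesis by (simp add: empirical_measure_def)
qed

text \<open>Taking the coordinate maps as the process turns the empirical measure into a
  deterministic function of a sequence. Its integrals are finite averages of \<open>f (x i)\<close>,
  hence continuous for the product topology.\<close>

lemma continuous_map_empirical_measure:
  assumes "n \<ge> 1"
  shows "continuous_map euclidean weak_topology
    (empirical_measure (\<lambda>i x. x i) n :: (nat \<Rightarrow> 'a::topological_space) \<Rightarrow> 'a measure)"
proof (rule continuous_map_weak_topologyI)
  fix f :: "'a \<Rightarrow>\<^sub>C real"
  have "continuous_on UNIV (\<lambda>x :: nat \<Rightarrow> 'a. apply_bcontfun f (x i))" for i
    by (rule continuous_on_compose2[OF continuous_on_apply_bcontfun[of UNIV f]])
       (auto intro: continuous_on_product_coordinates)
  then have "continuous_on UNIV (\<lambda>x :: nat \<Rightarrow> 'a. (\<Sum>i=1..n. apply_bcontfun f (x i)) / real n)"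
    using assms by (intro continuous_intros) auto
  moreover have "apply_bcontfun f \<in> borel_measurable borel"
    by (intro borel_measurable_continuous_onI) simp
  then have "(\<lambda>x :: nat \<Rightarrow> 'a. \<integral>y. apply_bcontfun f y \<partial>empirical_measure (\<lambda>i x. x i) n x) =
      (\<lambda>x. (\<Sum>i=1..n. apply_bcontfun f (x i)) / real n)"
    by (intro ext integral_empirical_measure)
  ultimately show "continuous_map euclidean euclidean
      (\<lambda>x :: nat \<Rightarrow> 'a. \<integral>y. apply_bcontfun f y \<partial>empirical_measure (\<lambda>i x. x i) n x)"
    by (simp only: continuous_map_iff_continuous2)
qed (rule empirical_measure_in_borel_probs[OF assms])

text \<open>Nothing is assumed about \<open>X 0\<close>, so \<open>max i 1\<close> puts
  \<open>X 1\<close> in its place. By second countability the product sigma-algebra is the Borel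
  sigma-algebra of the sequence space.\<close>

lemma measurable_process_to_function_space:
  fixes X :: "nat \<Rightarrow> 'w \<Rightarrow> 'a::second_countable_topology"
  assumes "\<And>n. n \<ge> 1 \<Longrightarrow> X n \<in> M \<rightarrow>\<^sub>M borel"
  shows "(\<lambda>\<omega> i. X (max i 1) \<omega>) \<in> M \<rightarrow>\<^sub>M borel"
proof -
  have "(\<lambda>\<omega>. \<lambda>i\<in>UNIV. X (max i 1) \<omega>) \<in> M \<rightarrow>\<^sub>M Pi\<^sub>M UNIV (\<lambda>i. borel)"
    by (intro measurable_restrict assms) auto
  then show ?thesis
    by (simp add: measurable_cong_sets[OF refl sets_PiM_equal_borel] restrict_UNIV)
qed

text \<open>Since \<open>weak_borel\<close> is generated by all weakly open sets, checking the
  subbasis would not do directly. Factoring through the path settles every open set at once: its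
  preimage in the sequence space is open.\<close>

lemma measurable_empirical_measure:
  fixes X :: "nat \<Rightarrow> 'w \<Rightarrow> 'a::second_countable_topology"
  assumes "\<And>n. n \<ge> 1 \<Longrightarrow> X n \<in> M \<rightarrow>\<^sub>M borel" "n \<ge> 1"
  shows "empirical_measure X n \<in> M \<rightarrow>\<^sub>M weak_borel"
proof -
  have "empirical_measure (\<lambda>i x. x i) n \<in> (borel :: (nat \<Rightarrow> 'a) measure) \<rightarrow>\<^sub>M weak_borel"
    unfolding weak_borel_def
  proof (rule measurable_measure_of)
    show "{U. openin weak_topology U} \<subseteq> Pow (borel_probs :: 'a measure set)"
      using openin_subset topspace_weak_topology by fastforce
    fix U :: "'a measure set" assume "U \<in> {U. openin weak_topology U}"
    then have "open {x. empirical_measure (\<lambda>i x :: nat \<Rightarrow> 'a. x i) n x \<in> U}"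
      using openin_continuous_map_preimage[OF continuous_map_empirical_measure[OF assms(2)]] by simp
    then show "empirical_measure (\<lambda>i x :: nat \<Rightarrow> 'a. x i) n -` U \<inter> space borel \<in> sets borel"
      by (simp add: vimage_def)
  qed (use assms(2) in \<open>auto intro: empirical_measure_in_borel_probs\<close>)
  from measurable_compose[OF measurable_process_to_function_space[of X M, OF assms(1)] this]
  have "(\<lambda>\<omega>. empirical_measure (\<lambda>i x. x i) n (\<lambda>i. X (max i 1) \<omega>)) \<in> M \<rightarrow>\<^sub>M weak_borel"
    by simp
  also have "(\<lambda>\<omega>. empirical_measure (\<lambda>i x. x i) n (\<lambda>i. X (max i 1) \<omega>)) = empirical_measure X n"
    by (intro ext empirical_measure_cong) (auto simp: max_def)
  finally show ?thesis .
qed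

text \<open>A continuous image of a countable dense set of sequences is dense in the range. The same
  \<open>D\<close> works for every process and outcome, because each empirical measure is the value
  at a path.\<close>

lemma separable_range_empirical_measure:
  assumes "metrizes_weak_convergence d" "n \<ge> 1"
  obtains D :: "'a::second_countable_topology measure set"
  where "countable D" "D \<subseteq> borel_probs"
    "\<And>(X :: nat \<Rightarrow> 'w \<Rightarrow> 'a) \<omega> e. e > 0 \<Longrightarrow> \<exists>q\<in>D. d q (empirical_measure X n \<omega>) < e"
proof -
  interpret Metric_space borel_probs d
    using assms(1) by (simp add: metrizes_weak_convergence_def)
  have top: "mtopology = weak_topology"
    using assms(1) by (simp add: metrizes_weak_convergence_def)
  obtain C :: "(nat \<Rightarrow> 'a) set" where C: "countable C"
    "\<And>U. open U \<Longrightarrow> U \<noteq> {} \<Longrightarrow> \<exists>c\<in>C. c \<in> U"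
    using countable_dense_exists by blast
  let ?E = "empirical_measure (\<lambda>i x :: nat \<Rightarrow> 'a. x i) n"
  have "\<exists>q\<in>?E ` C. d q (empirical_measure X n \<omega>) < e" if "e > 0" for X :: "nat \<Rightarrow> 'w \<Rightarrow> 'a" and \<omega> e
  proof -
    let ?x = "\<lambda>i. X i \<omega>"
    have eq: "empirical_measure X n \<omega> = ?E ?x" by (rule empirical_measure_cong) simp
    have "openin weak_topology (mball (?E ?x) e)"
      unfolding top[symmetric] by (rule openin_mball)
    then have "open {x. ?E x \<in> mball (?E ?x) e}"
      using openin_continuous_map_preimage[OF continuous_map_empirical_measure[OF assms(2)]]
      by (simp del: in_mball)
    moreover have "?x \<in> {x. ?E x \<in> mball (?E ?x) e}"
      using that assms by (simp add: empirical_measure_in_borel_probs)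
    ultimately obtain c where "c \<in> C" "?E c \<in> mball (?E ?x) e"
      using C(2) by blast
    then show ?thesis by (auto simp: eq commute)
  qed
  with C(1) show thesis
    by (intro that[of "?E ` C"]) (auto intro: empirical_measure_in_borel_probs[OF assms(2)])
qed

text \<open>Since the range of the empirical measure is separable, separability of the whole weak
  topology is not needed to measure its distance to \<open>P\<close>.\<close>

lemma measurable_dist_empirical_measure:
  fixes X :: "nat \<Rightarrow> 'w \<Rightarrow> 'a::second_countable_topology"
  assumes "metrizes_weak_convergence d" "\<And>n. n \<ge> 1 \<Longrightarrow> X n \<in> M \<rightarrow>\<^sub>M borel"
    and P: "P \<in> M \<rightarrow>\<^sub>M weak_borel" and n: "n \<ge> 1"
  shows "(\<lambda>\<omega>. d (empirical_measure X n \<omega>) (P \<omega>)) \<in> borel_measurable M"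
proof -
  interpret Metric_space borel_probs d
    using assms(1) by (simp add: metrizes_weak_convergence_def)
  have top: "mtopology = weak_topology"
    using assms(1) by (simp add: metrizes_weak_convergence_def)
  let ?Z = "empirical_measure X n"
  have Zp: "?Z \<omega> \<in> borel_probs" for \<omega>
    using n by (rule empirical_measure_in_borel_probs)
  have Pp: "P \<omega> \<in> borel_probs" if "\<omega> \<in> space M" for \<omega>
    using measurable_space[OF P that] by (simp add: space_weak_borel)
  have ball: "{\<omega>\<in>space M. d q (Q \<omega>) < r} \<in> sets M"
    if Q: "Q \<in> M \<rightarrow>\<^sub>M weak_borel" and "q \<in> borel_probs" for Q q r
  proof -
    have "mball q r \<in> sets weak_borel"
      using openin_mball[of q r] unfolding top by (rule openin_weak_topology_sets)
    from measurable_sets[OF Q this]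
    have "Q -` mball q r \<inter> space M \<in> sets M" .
    also have "Q -` mball q r \<inter> space M = {\<omega>\<in>space M. d q (Q \<omega>) < r}"
      using measurable_space[OF Q] that(2) by (auto simp: space_weak_borel)
    finally show ?thesis .
  qed
  obtain D where D: "countable D" "D \<subseteq> borel_probs"
    "\<And>(X :: nat \<Rightarrow> 'w \<Rightarrow> 'a) \<omega> e. e > 0 \<Longrightarrow> \<exists>q\<in>D. d q (empirical_measure X n \<omega>) < e"
    using separable_range_empirical_measure[OF assms(1) n] by metis
  show ?thesis
  proof (rule borel_measurableI_less)
    fix e
    have "{\<omega>\<in>space M. d (?Z \<omega>) (P \<omega>) < e} =
      (\<Union>q\<in>D. \<Union>r\<in>\<rat>. {\<omega>\<in>space M. d q (?Z \<omega>) < r} \<inter> {\<omega>\<in>space M. d q (P \<omega>) < e - r})" (is "?A = ?B")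
    proof (intro equalityI subsetI)
      show "\<omega> \<in> ?A" if B: "\<omega> \<in> ?B" for \<omega>
      proof -
        obtain q r where *: "q \<in> D" "\<omega> \<in> space M" "d q (?Z \<omega>) < r" "d q (P \<omega>) < e - r"
          using B by blast
        have "d (?Z \<omega>) (P \<omega>) \<le> d (?Z \<omega>) q + d q (P \<omega>)"
          using * D(2) Zp Pp by (intro triangle) auto
        with * show ?thesis by (simp add: commute)
      qed
      show "\<omega> \<in> ?B" if "\<omega> \<in> ?A" for \<omega>
      proof -
        have \<omega>: "\<omega> \<in> space M" "d (?Z \<omega>) (P \<omega>) < e" using that by auto
        \<comment> \<open>The bound
          \<open>d q (P \<omega>) < r + d (?Z \<omega>) (P \<omega>)\<close> has to stay below
          \<open>e - r\<close>, so \<open>r\<close> must be less than half the gap.\<close>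
        obtain r where r: "r \<in> \<rat>" "0 < r" "r < (e - d (?Z \<omega>) (P \<omega>)) / 2"
          using Rats_dense_in_real[of 0 "(e - d (?Z \<omega>) (P \<omega>)) / 2"] \<omega> by auto
        obtain q where q: "q \<in> D" "d q (?Z \<omega>) < r" using D(3)[OF r(2)] by blast
        have "d q (P \<omega>) \<le> d q (?Z \<omega>) + d (?Z \<omega>) (P \<omega>)"
          using q D(2) Zp Pp \<omega> by (intro triangle) auto
        also have "\<dots> < e - r" using q r by (simp add: field_simps)
        finally show ?thesis using q r \<omega> by blast
      qed
    qed
    also have "\<dots> \<in> sets M"
    proof (intro sets.countable_UN'' D countable_rat sets.Int)
      fix q r assume "q \<in> D"
      then have "q \<in> borel_probs" using D by auto
      then show "{\<omega>\<in>space M. d q (?Z \<omega>) < r} \<in> sets M" "{\<omega>\<in>space M. d q (P \<omega>) < e - r} \<in> sets M"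
        by (auto intro!: ball P measurable_empirical_measure assms)
    qed
    finally show "{\<omega>\<in>space M. d (?Z \<omega>) (P \<omega>) < e} \<in> sets M" .
  qed
qed

section \<open>Convergence in probability and almost sure subsequences\<close>

text \<open>Diagonal extraction: the index \<open>m n\<close> controls the rows
  \<open>i \<le> n\<close> simultaneously, finitely many at each stage, so each row is controlled
  from \<open>n = i\<close> on.\<close>

lemma (in prob_space) ex_subseq_AE_tendsto_0:
  fixes Y :: "nat \<Rightarrow> nat \<Rightarrow> 'a \<Rightarrow> real"
  assumes meas: "\<And>i n. Y i n \<in> borel_measurable M"
    and nonneg: "\<And>i n \<omega>. 0 \<le> Y i n \<omega>"
    and lim: "\<And>i e. e > 0 \<Longrightarrow> (\<lambda>n. \<P>(\<omega> in M. Y i n \<omega> > e)) \<longlonglongrightarrow> 0"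
  obtains m :: "nat \<Rightarrow> nat" where "strict_mono m" "AE \<omega> in M. \<forall>i. (\<lambda>n. Y i (m n) \<omega>) \<longlonglongrightarrow> 0"
proof -
  \<comment> \<open>The same numbers bound the values of \<open>Y\<close>, for which they must tend
    to 0, and the probabilities of exceeding them, for which they must be summable.\<close>
  define e :: "nat \<Rightarrow> real" where "e n = (1/2) ^ n" for n
  have e: "e n > 0" for n by (simp add: e_def)
  have e0: "e \<longlonglongrightarrow> 0" unfolding e_def by (rule LIMSEQ_realpow_zero) auto
  have summ: "summable e" unfolding e_def by (rule summable_geometric) simp
  have ev: "\<forall>\<^sub>F j in sequentially. \<forall>i\<in>{..n}. \<P>(\<omega> in M. Y i j \<omega> > e n) < e n" for n
    using order_tendstoD(2)[OF lim[OF e] e] by (intro eventually_ball_finite) auto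
  have "\<exists>m. \<forall>n. (\<forall>i\<in>{..n}. \<P>(\<omega> in M. Y i (m n) \<omega> > e n) < e n) \<and> m n < m (Suc n)"
  proof (rule dependent_nat_choice)
    show "\<exists>j. \<forall>i\<in>{..0}. \<P>(\<omega> in M. Y i j \<omega> > e 0) < e 0"
      using ev[of 0] eventually_happens'[OF sequentially_bot] by blast
    show "\<exists>j. (\<forall>i\<in>{..Suc n}. \<P>(\<omega> in M. Y i j \<omega> > e (Suc n)) < e (Suc n)) \<and> j' < j" for j' n
      using eventually_happens'[OF sequentially_bot
          eventually_conj[OF ev[of "Suc n"] eventually_gt_at_top[of j']]] by blast
  qed
  then obtain m where m: "\<And>n i. i \<le> n \<Longrightarrow> \<P>(\<omega> in M. Y i (m n) \<omega> > e n) < e n"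
    and mono: "strict_mono m"
    by (auto simp: strict_mono_Suc_iff)
  have "AE \<omega> in M. (\<lambda>n. Y i (m n) \<omega>) \<longlonglongrightarrow> 0" for i
  proof -
    have "AE \<omega> in M. \<forall>\<^sub>F n in sequentially. \<omega> \<in> space M - {\<omega>\<in>space M. Y i (m n) \<omega> > e n}"
    proof (rule borel_cantelli_AE1)
      show "{\<omega>\<in>space M. Y i (m n) \<omega> > e n} \<in> sets M" for n
        using meas by measurable
      \<comment> \<open>Row \<open>i\<close> is bounded by \<open>e n\<close> only for
        \<open>n \<ge> i\<close>; the finitely many earlier terms do not affect summability.\<close>
      show "summable (\<lambda>n. prob {\<omega>\<in>space M. Y i (m n) \<omega> > e n})"
        by (rule summable_comparison_test'[of e i])
           (use m summ in \<open>auto intro: less_imp_le\<close>)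
    qed (simp add: less_top[symmetric])
    then show ?thesis
    proof eventually_elim
      case (elim \<omega>)
      then have "\<forall>\<^sub>F n in sequentially. Y i (m n) \<omega> \<le> e n"
        by (auto elim: eventually_mono)
      then show ?case
        by (intro tendsto_sandwich[OF _ _ tendsto_const e0]) (auto simp: nonneg)
    qed
  qed
  then show thesis using mono by (intro that) (auto simp: AE_all_countable)
qed

text \<open>Dominated convergence for the indicators of the exceedance events, which vanish
  eventually at almost every outcome.\<close>

lemma (in prob_space) AE_tendsto_0_imp_prob_tendsto_0:
  fixes Y :: "nat \<Rightarrow> 'a \<Rightarrow> real"
  assumes [measurable]: "\<And>n. Y n \<in> borel_measurable M"
    and lim: "AE \<omega> in M. (\<lambda>n. Y n \<omega>) \<longlonglongrightarrow> 0" and "e > 0"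
  shows "(\<lambda>n. \<P>(\<omega> in M. Y n \<omega> > e)) \<longlonglongrightarrow> 0"
proof -
  have "(\<lambda>n. \<integral>\<omega>. indicator {\<omega>\<in>space M. Y n \<omega> > e} \<omega> \<partial>M) \<longlonglongrightarrow> (\<integral>\<omega>. (0::real) \<partial>M)"
  proof (rule integral_dominated_convergence[where w = "\<lambda>_. 1"])
    show "AE \<omega> in M. (\<lambda>n. indicator {\<omega>\<in>space M. Y n \<omega> > e} \<omega> :: real) \<longlonglongrightarrow> 0"
      using lim
    proof eventually_elim
      case (elim \<omega>)
      from order_tendstoD(2)[OF this \<open>e > 0\<close>]
      show ?case by (intro tendsto_eventually) (auto elim!: eventually_mono simp: indicator_def)
    qed
  qed (auto simp: indicator_def)
  then show ?thesis by simp
qed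

text \<open>Almost sure convergence along sub-subsequences does not pass to the full sequence, but
  the exceedance probabilities form a real sequence, and for those the subsequence principle
  holds.\<close>

lemma (in prob_space) tendsto_in_prob_subseqI:
  fixes d :: "'b \<Rightarrow> 'b \<Rightarrow> real"
  assumes meas: "\<And>n. n > 0 \<Longrightarrow> (\<lambda>\<omega>. d (Z n \<omega>) (Z' \<omega>)) \<in> borel_measurable M"
    and sub: "\<And>k. strict_mono k \<Longrightarrow> (\<And>n. k n > (0::nat)) \<Longrightarrow>
      \<exists>m::nat \<Rightarrow> nat. strict_mono m \<and> (AE \<omega> in M. (\<lambda>n. d (Z (k (m n)) \<omega>) (Z' \<omega>)) \<longlonglongrightarrow> 0)"
  shows "tendsto_in_prob M d Z Z'"
  unfolding tendsto_in_prob_def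
proof (intro allI impI)
  fix e :: real assume "e > 0"
  define a where "a n = \<P>(\<omega> in M. d (Z n \<omega>) (Z' \<omega>) > e)" for n
  have "a \<longlonglongrightarrow> 0"
  proof (rule ccontr)
    assume "\<not> a \<longlonglongrightarrow> 0"
    then obtain \<delta> where \<delta>: "\<delta> > 0" "\<not> (\<forall>\<^sub>F n in sequentially. a n < \<delta>)"
      by (auto simp: tendsto_iff a_def)
    \<comment> \<open>Dropping index 0 makes the enumeration of bad indices an admissible
      \<open>k\<close> and keeps it within the range where measurability is known.\<close>
    have "infinite {n. n > 0 \<and> a n \<ge> \<delta>}"
    proof
      assume "finite {n. n > 0 \<and> a n \<ge> \<delta>}"
      then have "\<forall>\<^sub>F n in sequentially. n \<notin> {n. n > 0 \<and> a n \<ge> \<delta>}"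
        by (simp add: eventually_cofinite flip: cofinite_eq_sequentially)
      then have "\<forall>\<^sub>F n in sequentially. a n < \<delta>"
        using eventually_gt_at_top[of 0] by eventually_elim auto
      with \<delta> show False by simp
    qed
    then obtain k :: "nat \<Rightarrow> nat" where k: "strict_mono k" "\<And>n. k n > 0" "\<And>n. a (k n) \<ge> \<delta>"
      using infinite_enumerate by blast
    obtain m where m: "AE \<omega> in M. (\<lambda>n. d (Z (k (m n)) \<omega>) (Z' \<omega>)) \<longlonglongrightarrow> 0"
      using sub[OF k(1,2)] by blast
    have "(\<lambda>n. a (k (m n))) \<longlonglongrightarrow> 0"
      unfolding a_def by (rule AE_tendsto_0_imp_prob_tendsto_0[OF meas[OF k(2)] m \<open>e > 0\<close>])
    from LIMSEQ_le_const[OF this, of \<delta>] k \<delta> show False by auto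
  qed
  then show "(\<lambda>n. \<P>(\<omega> in M. d (Z n \<omega>) (Z' \<omega>) > e)) \<longlonglongrightarrow> 0"
    unfolding a_def .
qed

text \<open>A nonmeasurable event has measure 0 by convention, so the left side also asserts
  measurability. From the right side, completeness makes the complement of the event a null set,
  hence measurable.\<close>

lemma (in prob_space) complete_prob_eq_1_iff_AE:
  assumes "complete_measure M"
  shows "\<P>(\<omega> in M. Q \<omega>) = 1 \<longleftrightarrow> (AE \<omega> in M. Q \<omega>)"
proof
  assume "AE \<omega> in M. Q \<omega>"
  then have "{\<omega>\<in>space M. \<not> Q \<omega>} \<in> null_sets M"
    using complete_measure.AE_iff_null_sets[OF assms] by blast
  then have "space M - {\<omega>\<in>space M. \<not> Q \<omega>} \<in> sets M" by auto
  also have "space M - {\<omega>\<in>space M. \<not> Q \<omega>} = {\<omega>\<in>space M. Q \<omega>}" by auto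
  finally show "\<P>(\<omega> in M. Q \<omega>) = 1" using \<open>AE \<omega> in M. Q \<omega>\<close> by (simp add: prob_Collect_eq_1)
qed (auto dest: AE_prob_1)

text \<open>The terms are nonnegative, so the lower limit is at least 0 and a vanishing upper limit
  forces convergence.\<close>

lemma limsup_abs_diff_eq_0_iff:
  fixes a :: "nat \<Rightarrow> real"
  shows "limsup (\<lambda>n. ereal \<bar>a n - b\<bar>) = 0 \<longleftrightarrow> a \<longlonglongrightarrow> b"
proof -
  have "limsup (\<lambda>n. ereal \<bar>a n - b\<bar>) = 0 \<longleftrightarrow> (\<lambda>n. ereal \<bar>a n - b\<bar>) \<longlonglongrightarrow> ereal 0"
  proof (intro iffI)
    assume *: "limsup (\<lambda>n. ereal \<bar>a n - b\<bar>) = 0"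
    have "0 \<le> liminf (\<lambda>n. ereal \<bar>a n - b\<bar>)" by (intro Liminf_bounded) auto
    with * Liminf_le_Limsup[of sequentially "\<lambda>n. ereal \<bar>a n - b\<bar>"]
    show "(\<lambda>n. ereal \<bar>a n - b\<bar>) \<longlonglongrightarrow> ereal 0"
      by (subst tendsto_iff_Liminf_eq_Limsup) (auto simp: zero_ereal_def)
  next
    assume "(\<lambda>n. ereal \<bar>a n - b\<bar>) \<longlonglongrightarrow> ereal 0"
    from lim_imp_Limsup[OF sequentially_bot this]
    show "limsup (\<lambda>n. ereal \<bar>a n - b\<bar>) = 0" by (simp add: zero_ereal_def)
  qed
  also have "\<dots> \<longleftrightarrow> a \<longlonglongrightarrow> b"
    by (simp only: lim_ereal) (simp add: tendsto_rabs_zero_iff LIM_zero_iff)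
  finally show ?thesis .
qed

section \<open>A countable convergence-determining family on a compact space\<close>

lemma compact_finite_partition_of_unity:
  assumes "compact (UNIV :: 'a::metric_space set)" "e > 0"
  obtains C :: "'a::metric_space set" and \<phi> :: "'a \<Rightarrow> 'a \<Rightarrow>\<^sub>C real"
  where "finite C" "\<And>c x. 0 \<le> apply_bcontfun (\<phi> c) x"
    "\<And>x. (\<Sum>c\<in>C. apply_bcontfun (\<phi> c) x) = 1"
    "\<And>c x. apply_bcontfun (\<phi> c) x \<noteq> 0 \<Longrightarrow> dist c x < e"
proof -
  obtain C :: "'a set" where C: "finite C" "UNIV \<subseteq> (\<Union>c\<in>C. ball c e)"
    using assms unfolding compact_eq_totally_bounded by blast
  \<comment> \<open>Tent functions supported in the balls of a finite cover. Their sum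
    \<open>S\<close> is positive everywhere, so dividing by it normalizes them.\<close>
  define h where "h c x = max 0 (e - dist c x)" for c x :: 'a
  define S where "S x = (\<Sum>c\<in>C. h c x)" for x
  have h0: "h c x \<ge> 0" for c x by (simp add: h_def)
  have S: "S x > 0" for x
  proof -
    have "x \<in> (\<Union>c\<in>C. ball c e)" using C(2) by blast
    then obtain c where "c \<in> C" "dist c x < e" by auto
    then show ?thesis unfolding S_def by (intro sum_pos2[OF C(1), of c]) (auto simp: h_def)
  qed
  have conth: "continuous_on UNIV (h c)" for c
    unfolding h_def by (intro continuous_intros)
  have cont: "continuous_on UNIV (\<lambda>x. h c x / S x)" for c
    using S unfolding S_def by (intro continuous_intros conth) (metis less_irrefl)
  \<comment> \<open>Compactness bounds the continuous quotient, as the type of test functions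
    requires.\<close>
  have b: "(\<lambda>x. h c x / S x) \<in> bcontfun" for c
    using cont[of c] compact_continuous_image[OF cont[of c] assms(1)]
    by (simp add: bcontfun_def compact_imp_bounded)
  show thesis
  proof (rule that[of C "\<lambda>c. Bcontfun (\<lambda>x. h c x / S x)"])
    fix x
    have "(\<Sum>c\<in>C. h c x / S x) = 1"
      using S[of x] by (simp add: S_def flip: sum_divide_distrib)
    then show "(\<Sum>c\<in>C. apply_bcontfun (Bcontfun (\<lambda>x. h c x / S x)) x) = 1"
      by (simp add: Bcontfun_inverse[OF b])
    fix c
    show "0 \<le> apply_bcontfun (Bcontfun (\<lambda>x. h c x / S x)) x"
      using h0[of c x] S[of x] by (simp add: Bcontfun_inverse[OF b])
    show "dist c x < e" if "apply_bcontfun (Bcontfun (\<lambda>x. h c x / S x)) x \<noteq> 0"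
      using that unfolding Bcontfun_inverse[OF b] by (auto simp: h_def max_def split: if_splits)
  qed (rule C)
qed

text \<open>By uniform continuity, the sums \<open>\<Sum>c\<in>C. f c * \<phi> c\<close> over partitions of unity of shrinking mesh
  approximate \<open>f\<close> uniformly, and there are only countably many functions \<open>\<phi> c\<close>.\<close>

lemma compact_countable_convergence_determining:
  assumes comp: "compact (UNIV :: 'a::metric_space set)"
  obtains g :: "nat \<Rightarrow> 'a::metric_space \<Rightarrow>\<^sub>C real"
  where "\<forall>(\<mu> :: nat \<Rightarrow> 'a measure) \<nu> (f :: 'a \<Rightarrow>\<^sub>C real). (\<forall>n. \<mu> n \<in> borel_probs) \<longrightarrow> \<nu> \<in> borel_probs \<longrightarrow>
    (\<forall>i. (\<lambda>n. \<integral>x. apply_bcontfun (g i) x \<partial>\<mu> n) \<longlonglongrightarrow> (\<integral>x. apply_bcontfun (g i) x \<partial>\<nu>)) \<longrightarrow>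
    (\<lambda>n. \<integral>x. apply_bcontfun f x \<partial>\<mu> n) \<longlonglongrightarrow> (\<integral>x. apply_bcontfun f x \<partial>\<nu>)"
proof -
  define Q where "Q N C \<phi> \<longleftrightarrow> finite C \<and> (\<forall>c x. 0 \<le> apply_bcontfun (\<phi> c) x) \<and>
      (\<forall>x. (\<Sum>c\<in>C. apply_bcontfun (\<phi> c) x) = 1) \<and>
      (\<forall>c x. apply_bcontfun (\<phi> c) x \<noteq> 0 \<longrightarrow> dist c x < inverse (real (Suc N)))"
    for N C and \<phi> :: "'a \<Rightarrow> 'a \<Rightarrow>\<^sub>C real"
  have "\<exists>C \<phi>. Q N C \<phi>" for N
  proof (rule compact_finite_partition_of_unity[OF comp, of "inverse (real (Suc N))"])
    show "\<exists>C \<phi>. Q N C \<phi>"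
      if "finite C" "\<And>c x. 0 \<le> apply_bcontfun (\<phi> c) x"
        "\<And>x. (\<Sum>c\<in>C. apply_bcontfun (\<phi> c) x) = 1"
        "\<And>c x. apply_bcontfun (\<phi> c) x \<noteq> 0 \<Longrightarrow> dist c x < inverse (real (Suc N))"
      for C and \<phi> :: "'a \<Rightarrow> 'a \<Rightarrow>\<^sub>C real"
      using that unfolding Q_def by (intro exI[of _ C] exI[of _ \<phi>]) simp
  qed simp
  then obtain C \<phi> where Q: "\<And>N. Q N (C N) (\<phi> N)" by metis
  have C: "\<And>N. finite (C N)" and \<phi>0: "\<And>N c x. 0 \<le> apply_bcontfun (\<phi> N c) x"
    and \<phi>1: "\<And>N x. (\<Sum>c\<in>C N. apply_bcontfun (\<phi> N c) x) = 1"
    and \<phi>e: "\<And>N c x. apply_bcontfun (\<phi> N c) x \<noteq> 0 \<Longrightarrow> dist c x < inverse (real (Suc N))"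
    using Q unfolding Q_def by simp_all
  define G where "G = insert 0 (\<Union>N. \<phi> N ` C N)"
  have G: "countable G" "G \<noteq> {}"
    unfolding G_def
    by (auto intro!: countable_UN countable_finite[OF finite_imageI[OF C]])
  show thesis
  proof (rule that[of "from_nat_into G"], intro allI impI)
    fix \<mu> :: "nat \<Rightarrow> 'a measure" and \<nu> and f :: "'a \<Rightarrow>\<^sub>C real"
    assume \<mu>: "\<forall>n. \<mu> n \<in> borel_probs" and \<nu>: "\<nu> \<in> borel_probs"
      and lim: "\<forall>i. (\<lambda>n. \<integral>x. apply_bcontfun (from_nat_into G i) x \<partial>\<mu> n)
        \<longlonglongrightarrow> (\<integral>x. apply_bcontfun (from_nat_into G i) x \<partial>\<nu>)"
    have lim\<phi>: "(\<lambda>n. \<integral>x. apply_bcontfun (\<phi> N c) x \<partial>\<mu> n) \<longlonglongrightarrow> (\<integral>x. apply_bcontfun (\<phi> N c) x \<partial>\<nu>)"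
      if "c \<in> C N" for N c
    proof -
      have "\<phi> N c \<in> G" using that unfolding G_def by blast
      from from_nat_into_surj[OF G(1) this] obtain i where i: "from_nat_into G i = \<phi> N c" ..
      show ?thesis using lim[rule_format, of i] unfolding i .
    qed
    show "(\<lambda>n. \<integral>x. apply_bcontfun f x \<partial>\<mu> n) \<longlonglongrightarrow> (\<integral>x. apply_bcontfun f x \<partial>\<nu>)"
    proof (rule LIMSEQ_I)
      fix e :: real assume e: "e > 0"
      have "uniformly_continuous_on UNIV (apply_bcontfun f)"
        by (intro compact_uniformly_continuous comp) simp
      then obtain \<delta> where \<delta>: "\<delta> > 0"
        "\<And>x y. dist x y < \<delta> \<Longrightarrow> dist (apply_bcontfun f x) (apply_bcontfun f y) < e / 3"
        unfolding uniformly_continuous_on_def using e by (metis UNIV_I zero_less_divide_iff zero_less_numeral)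
      obtain N where N: "inverse (real (Suc N)) < \<delta>"
        using reals_Archimedean[OF \<delta>(1)] by blast
      \<comment> \<open>This is the integral of the approximant. It involves only finitely many
        integrals of functions \<open>\<phi> N c\<close>, whose limits are given.\<close>
      define s where "s \<rho> = (\<Sum>c\<in>C N. apply_bcontfun f c * (\<integral>x. apply_bcontfun (\<phi> N c) x \<partial>\<rho>))" for \<rho>
      \<comment> \<open>The error is uniform in \<open>\<rho>\<close>, since a sup-norm bound
        integrates to itself under a probability measure. It is spent at \<open>\<mu> n\<close> and
        at \<open>\<nu>\<close>; the last third of \<open>e\<close> covers the change of
        \<open>s\<close>.\<close>
      have approx: "\<bar>(\<integral>x. apply_bcontfun f x \<partial>\<rho>) - s \<rho>\<bar> \<le> e / 3" if \<rho>: "\<rho> \<in> borel_probs" for \<rho>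
      proof -
        interpret prob_space \<rho> using \<rho> by (simp add: borel_probs_def)
        note int = integrable_bcontfun[OF \<rho>]
        let ?s = "\<lambda>x. \<Sum>c\<in>C N. apply_bcontfun f c * apply_bcontfun (\<phi> N c) x"
        have ints: "integrable \<rho> ?s" by (intro Bochner_Integration.integrable_sum integrable_mult_right int)
        have pt: "\<bar>apply_bcontfun f x - ?s x\<bar> \<le> e / 3" for x
        proof -
          \<comment> \<open>The weights sum to 1, so the difference is a weighted average of
            \<open>f x - f c\<close>, and only points \<open>c\<close> within
            \<open>\<delta>\<close> of \<open>x\<close> carry weight.\<close>
          have "apply_bcontfun f x - ?s x =
              (\<Sum>c\<in>C N. apply_bcontfun f x * apply_bcontfun (\<phi> N c) x) - ?s x"
            by (simp add: \<phi>1 flip: sum_distrib_left)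
          also have "\<dots> = (\<Sum>c\<in>C N. (apply_bcontfun f x - apply_bcontfun f c) * apply_bcontfun (\<phi> N c) x)"
            by (simp add: sum_subtractf left_diff_distrib)
          also have "\<bar>\<dots>\<bar> \<le> (\<Sum>c\<in>C N. \<bar>(apply_bcontfun f x - apply_bcontfun f c) * apply_bcontfun (\<phi> N c) x\<bar>)"
            by (rule sum_abs)
          also have "\<dots> \<le> (\<Sum>c\<in>C N. e / 3 * apply_bcontfun (\<phi> N c) x)"
          proof (rule sum_mono)
            fix c
            show "\<bar>(apply_bcontfun f x - apply_bcontfun f c) * apply_bcontfun (\<phi> N c) x\<bar>
                \<le> e / 3 * apply_bcontfun (\<phi> N c) x"
            proof (cases "apply_bcontfun (\<phi> N c) x = 0")
              case False
              then have "dist x c < \<delta>" using \<phi>e[of N c x] N by (simp add: dist_commute)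
              from \<delta>(2)[OF this]
              have "\<bar>apply_bcontfun f x - apply_bcontfun f c\<bar> \<le> e / 3" by (simp add: dist_real_def)
              from mult_right_mono[OF this \<phi>0] show ?thesis
                using \<phi>0 by (simp add: abs_mult)
            qed simp
          qed
          also have "\<dots> = e / 3" unfolding sum_distrib_left[symmetric] \<phi>1 by simp
          finally show ?thesis .
        qed
        have "s \<rho> = (\<integral>x. ?s x \<partial>\<rho>)"
          unfolding s_def by (subst Bochner_Integration.integral_sum) (auto intro: int)
        then have "\<bar>(\<integral>x. apply_bcontfun f x \<partial>\<rho>) - s \<rho>\<bar> = \<bar>\<integral>x. apply_bcontfun f x - ?s x \<partial>\<rho>\<bar>"
          using int ints by simp
        also have "\<dots> \<le> (\<integral>x. \<bar>apply_bcontfun f x - ?s x\<bar> \<partial>\<rho>)"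
          by (rule integral_abs_bound)
        also have "\<dots> \<le> (\<integral>x. e / 3 \<partial>\<rho>)"
          using pt int ints by (intro integral_mono) auto
        finally show ?thesis by (simp add: prob_space)
      qed
      have "(\<lambda>n. s (\<mu> n)) \<longlonglongrightarrow> s \<nu>"
        unfolding s_def by (intro tendsto_intros lim\<phi>)
      from LIMSEQ_D[OF this, of "e / 3"] e obtain n0 where n0: "\<And>n. n \<ge> n0 \<Longrightarrow> \<bar>s (\<mu> n) - s \<nu>\<bar> < e / 3"
        by auto
      have "norm ((\<integral>x. apply_bcontfun f x \<partial>\<mu> n) - (\<integral>x. apply_bcontfun f x \<partial>\<nu>)) < e" if "n \<ge> n0" for n
        using approx[OF \<mu>[rule_format, of n]] approx[OF \<nu>] n0[OF that] unfolding real_norm_def by linarith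
      then show "\<exists>no. \<forall>n\<ge>no. norm ((\<integral>x. apply_bcontfun f x \<partial>\<mu> n) - (\<integral>x. apply_bcontfun f x \<partial>\<nu>)) < e"
        by blast
    qed
  qed
qed

section \<open>Equivalence of the modes of convergence\<close>

text \<open>The metric is arbitrary, so only its topology can be used; this exchanges the quantifier
  over all test functions for one measurable real sequence in the applications.\<close>

lemma metrizes_weak_convergence_tendsto_iff:
  fixes d :: "'a::topological_space measure \<Rightarrow> 'a measure \<Rightarrow> real"
  assumes "metrizes_weak_convergence d" "\<And>n. \<mu> n \<in> borel_probs" "\<nu> \<in> borel_probs"
  shows "(\<lambda>n. d (\<mu> n) \<nu>) \<longlonglongrightarrow> 0 \<longleftrightarrow> (\<forall>f :: 'a \<Rightarrow>\<^sub>C real.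
    (\<lambda>n. \<integral>x. apply_bcontfun f x \<partial>\<mu> n) \<longlonglongrightarrow> (\<integral>x. apply_bcontfun f x \<partial>\<nu>))"
proof -
  interpret Metric_space borel_probs d
    using assms(1) by (simp add: metrizes_weak_convergence_def)
  have top: "mtopology = weak_topology"
    using assms(1) by (simp add: metrizes_weak_convergence_def)
  have "(\<lambda>n. d (\<mu> n) \<nu>) \<longlonglongrightarrow> 0 \<longleftrightarrow> limitin mtopology \<mu> \<nu> sequentially"
    using assms(2,3) by (simp add: limitin_metric tendsto_iff)
  then show ?thesis
    using assms(2,3) by (simp add: top limitin_weak_topology)
qed

lemma measurable_dist_integral_empirical_measure:
  fixes X :: "nat \<Rightarrow> 'w \<Rightarrow> 'a::second_countable_topology" and f :: "'a \<Rightarrow>\<^sub>C real"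
  assumes "\<And>n. n \<ge> 1 \<Longrightarrow> X n \<in> M \<rightarrow>\<^sub>M borel" "P \<in> M \<rightarrow>\<^sub>M weak_borel" "n \<ge> 1"
  shows "(\<lambda>\<omega>. dist (\<integral>x. apply_bcontfun f x \<partial>empirical_measure X n \<omega>)
    (\<integral>x. apply_bcontfun f x \<partial>P \<omega>)) \<in> borel_measurable M"
proof (rule borel_measurable_dist)
  show "(\<lambda>\<omega>. \<integral>x. apply_bcontfun f x \<partial>empirical_measure X n \<omega>) \<in> borel_measurable M"
    by (rule measurable_compose[OF measurable_empirical_measure measurable_integral_weak_borel])
       (use assms in auto)
  show "(\<lambda>\<omega>. \<integral>x. apply_bcontfun f x \<partial>P \<omega>) \<in> borel_measurable M"
    by (rule measurable_compose[OF assms(2) measurable_integral_weak_borel])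
qed

lemma tendsto_in_prob_subseqD:
  assumes "tendsto_in_prob M d Z Z'" "strict_mono k" "e > 0"
  shows "(\<lambda>n. \<P>(\<omega> in M. d (Z (k n) \<omega>) (Z' \<omega>) > e)) \<longlonglongrightarrow> 0"
proof -
  have "(\<lambda>n. \<P>(\<omega> in M. d (Z n \<omega>) (Z' \<omega>) > e)) \<longlonglongrightarrow> 0"
    using assms(1,3) unfolding tendsto_in_prob_def by blast
  from LIMSEQ_subseq_LIMSEQ[OF this assms(2)] show ?thesis by (simp add: o_def)
qed

theorem theorem3p5:
  fixes M :: "'w measure"
    and d :: "'a::polish_space measure \<Rightarrow> 'a measure \<Rightarrow> real"
    and X :: "nat \<Rightarrow> 'w \<Rightarrow> 'a"
    and P :: "'w \<Rightarrow> 'a measure"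
  assumes "complete_standard_borel_prob_space M"
    and "metrizes_weak_convergence d"
    and "\<And>n. n \<ge> 1 \<Longrightarrow> X n \<in> M \<rightarrow>\<^sub>M borel"
    and "random_measure M P"
  shows "(EWC_in_prob_with_limit M d X P \<longleftrightarrow> subseq_AS_weak_convergence M X P) \<and>
    (subseq_AS_weak_convergence M X P \<longrightarrow> integrals_tendsto_in_prob M X P) \<and>
    (compact (UNIV :: 'a set) \<longrightarrow>
       (integrals_tendsto_in_prob M X P \<longrightarrow> subseq_AS_weak_convergence M X P) \<and>
       (EWC_in_prob_with_limit M d X P \<longleftrightarrow> subseq_AS_weak_convergence M X P) \<and>
       (subseq_AS_weak_convergence M X P \<longleftrightarrow> integrals_tendsto_in_prob M X P))"
proof -
  interpret prob_space M
    using assms(1) by (simp add: complete_standard_borel_prob_space_def)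
  have complete: "complete_measure M"
  proof -
    obtain N where "M = completion N"
      using assms(1) unfolding complete_standard_borel_prob_space_def by blast
    then show ?thesis by (simp only: completion.complete_measure_axioms)
  qed
  have P: "P \<in> M \<rightarrow>\<^sub>M weak_borel" using assms(4) by (simp add: random_measure_def)
  have Pp: "P \<omega> \<in> borel_probs" if "\<omega> \<in> space M" for \<omega>
    using measurable_space[OF P that] by (simp add: space_weak_borel)
  let ?E = "empirical_measure X"
  let ?I = "\<lambda>(f :: 'a \<Rightarrow>\<^sub>C real) \<mu>. \<integral>x. apply_bcontfun f x \<partial>\<mu>"
  have Ep: "?E n \<omega> \<in> borel_probs" if "n > 0" for n \<omega>
    using that by (intro empirical_measure_in_borel_probs) simp
  note md = measurable_dist_empirical_measure[OF assms(2,3) P]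
  note mi = measurable_dist_integral_empirical_measure[of X M P, OF assms(3) P]
  interpret Metric_space borel_probs d
    using assms(2) by (simp add: metrizes_weak_convergence_def)
  have subseq: "subseq_AS_weak_convergence M X P \<longleftrightarrow>
    (\<forall>k :: nat \<Rightarrow> nat. strict_mono k \<and> (\<forall>n. k n > 0) \<longrightarrow> (\<exists>m :: nat \<Rightarrow> nat. strict_mono m \<and>
      (AE \<omega> in M. \<forall>f. (\<lambda>n. ?I f (?E (k (m n)) \<omega>)) \<longlonglongrightarrow> ?I f (P \<omega>))))"
    unfolding subseq_AS_weak_convergence_def limsup_abs_diff_eq_0_iff
      complete_prob_eq_1_iff_AE[OF complete] ..
  have weak_iff: "(AE \<omega> in M. \<forall>f. (\<lambda>n. ?I f (?E (k (m n)) \<omega>)) \<longlonglongrightarrow> ?I f (P \<omega>)) \<longleftrightarrow>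
      (AE \<omega> in M. (\<lambda>n. d (?E (k (m n)) \<omega>) (P \<omega>)) \<longlonglongrightarrow> 0)"
    if "\<And>n. k n > 0" for k m :: "nat \<Rightarrow> nat"
    by (intro AE_cong metrizes_weak_convergence_tendsto_iff[OF assms(2), symmetric] Ep Pp that)

  have i_ii: "subseq_AS_weak_convergence M X P" if "EWC_in_prob_with_limit M d X P"
    unfolding subseq
  proof (intro allI impI, elim conjE)
    fix k :: "nat \<Rightarrow> nat" assume k: "strict_mono k" "\<forall>n. k n > 0"
    have T: "tendsto_in_prob M d ?E P" using that by (simp add: EWC_in_prob_with_limit_def)
    \<comment> \<open>All rows are equal here; the index \<open>i\<close> is a dummy.\<close>
    obtain m where "strict_mono m" "AE \<omega> in M. \<forall>i::nat. (\<lambda>n. d (?E (k (m n)) \<omega>) (P \<omega>)) \<longlonglongrightarrow> 0"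
    proof (rule ex_subseq_AE_tendsto_0[of "\<lambda>i n \<omega>. d (?E (k n) \<omega>) (P \<omega>)"])
      show "(\<lambda>\<omega>. d (?E (k n) \<omega>) (P \<omega>)) \<in> borel_measurable M" for n
        using k(2) by (intro md) (auto simp: Suc_le_eq)
    qed (use tendsto_in_prob_subseqD[OF T k(1)] in auto)
    with weak_iff[of k m] k(2)
    show "\<exists>m. strict_mono m \<and> (AE \<omega> in M. \<forall>f. (\<lambda>n. ?I f (?E (k (m n)) \<omega>)) \<longlonglongrightarrow> ?I f (P \<omega>))"
      by auto
  qed
  have ii_i: "EWC_in_prob_with_limit M d X P" if "subseq_AS_weak_convergence M X P"
    unfolding EWC_in_prob_with_limit_def
  proof (intro conjI assms(4) tendsto_in_prob_subseqI)
    fix k :: "nat \<Rightarrow> nat" assume "strict_mono k" "\<And>n. k n > 0"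
    with that weak_iff[of k]
    show "\<exists>m. strict_mono m \<and> (AE \<omega> in M. (\<lambda>n. d (?E (k (m n)) \<omega>) (P \<omega>)) \<longlonglongrightarrow> 0)"
      unfolding subseq by blast
  qed (auto intro: md)
  have ii_iii: "integrals_tendsto_in_prob M X P" if "subseq_AS_weak_convergence M X P"
    unfolding integrals_tendsto_in_prob_def
  proof (intro allI tendsto_in_prob_subseqI)
    fix f and k :: "nat \<Rightarrow> nat" assume "strict_mono k" "\<And>n. k n > 0"
    with that obtain m where m: "strict_mono m"
      "AE \<omega> in M. \<forall>f. (\<lambda>n. ?I f (?E (k (m n)) \<omega>)) \<longlonglongrightarrow> ?I f (P \<omega>)"
      unfolding subseq by blast
    \<comment> \<open>The null set from the second statement is common to all functions, so it may
      be used for the fixed \<open>f\<close>.\<close>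
    from m(2) have "AE \<omega> in M. (\<lambda>n. dist (?I f (?E (k (m n)) \<omega>)) (?I f (P \<omega>))) \<longlonglongrightarrow> 0"
      by eventually_elim (simp flip: tendsto_dist_iff)
    with m(1) show "\<exists>m. strict_mono m \<and>
        (AE \<omega> in M. (\<lambda>n. dist (?I f (?E (k (m n)) \<omega>)) (?I f (P \<omega>))) \<longlonglongrightarrow> 0)" by blast
  qed (auto intro: mi)
  have iii_ii: "subseq_AS_weak_convergence M X P"
    if "integrals_tendsto_in_prob M X P" and comp: "compact (UNIV :: 'a set)"
    unfolding subseq
  proof (intro allI impI, elim conjE)
    fix k :: "nat \<Rightarrow> nat" assume k: "strict_mono k" "\<forall>n. k n > 0"
    obtain g :: "nat \<Rightarrow> 'a \<Rightarrow>\<^sub>C real" where g: "\<forall>(\<mu> :: nat \<Rightarrow> 'a measure) \<nu> f.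
        (\<forall>n. \<mu> n \<in> borel_probs) \<longrightarrow> \<nu> \<in> borel_probs \<longrightarrow>
        (\<forall>i. (\<lambda>n. ?I (g i) (\<mu> n)) \<longlonglongrightarrow> ?I (g i) \<nu>) \<longrightarrow> (\<lambda>n. ?I f (\<mu> n)) \<longlonglongrightarrow> ?I f \<nu>"
      by (rule compact_countable_convergence_determining[OF comp])
    have T: "tendsto_in_prob M dist (\<lambda>n \<omega>. ?I f (?E n \<omega>)) (\<lambda>\<omega>. ?I f (P \<omega>))" for f
      using that by (simp add: integrals_tendsto_in_prob_def)
    obtain m where m: "strict_mono m"
      "AE \<omega> in M. \<forall>i. (\<lambda>n. dist (?I (g i) (?E (k (m n)) \<omega>)) (?I (g i) (P \<omega>))) \<longlonglongrightarrow> 0"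
    proof (rule ex_subseq_AE_tendsto_0[of "\<lambda>i n \<omega>. dist (?I (g i) (?E (k n) \<omega>)) (?I (g i) (P \<omega>))"])
      show "(\<lambda>\<omega>. dist (?I (g i) (?E (k n) \<omega>)) (?I (g i) (P \<omega>))) \<in> borel_measurable M" for i n
        using k(2) by (intro mi) (auto simp: Suc_le_eq)
    qed (use tendsto_in_prob_subseqD[OF T k(1)] in auto)
    \<comment> \<open>Outside one null set all the \<open>g i\<close> converge, and the extension to
      every \<open>f\<close> is a deterministic argument at each outcome. \<open>AE_space\<close> is
      added because \<open>P \<omega>\<close> is known to be a probability measure only on
      \<open>space M\<close>.\<close>
    have "AE \<omega> in M. \<forall>f. (\<lambda>n. ?I f (?E (k (m n)) \<omega>)) \<longlonglongrightarrow> ?I f (P \<omega>)"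
      using m(2) AE_space
    proof eventually_elim
      case (elim \<omega>)
      show ?case
      proof (rule allI, rule g[rule_format])
        show "?E (k (m n)) \<omega> \<in> borel_probs" for n using k(2) by (intro Ep) blast
        show "P \<omega> \<in> borel_probs" by (intro Pp elim(2))
        show "(\<lambda>n. ?I (g i) (?E (k (m n)) \<omega>)) \<longlonglongrightarrow> ?I (g i) (P \<omega>)" for i
          unfolding tendsto_dist_iff[of _ "?I (g i) (P \<omega>)"] using elim(1) by blast
      qed
    qed
    with m(1) show "\<exists>m. strict_mono m \<and>
        (AE \<omega> in M. \<forall>f. (\<lambda>n. ?I f (?E (k (m n)) \<omega>)) \<longlonglongrightarrow> ?I f (P \<omega>))" by blast
  qed
  from i_ii ii_i ii_iii iii_ii show ?thesis by blast
qed

end
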